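(* Let $(A,\circ,[\cdot,\cdot])$ be a finite-dimensional GD algebra over $\Bbbk$. Assume that (1) for every $x\in A$ the operator $\operatorname{ad}_x$ is nilpotent; (2) for every $x\in A$ the operators $L_x$ and $R_x$ are nilpotent; (3) the ideal $\mathcal I_{R\operatorname{ad}}$ of $\mathcal M(A)$ is a nil ideal, that is, every element of $\mathcal I_{R\operatorname{ad}}$ is nilpotent. Then $A$ is nilpotent (as a GD algebra).
   Context: $\Bbbk$ is an algebraically closed field of characteristic $0$. A Novikov algebra is a vector space with a bilinear product $\circ$ satisfying $(x\circ y)\circ z-x\circ(y\circ z)=(y\circ x)\circ z-y\circ(x\circ z)$ and $(x\circ y)\circ z=(x\circ z)\circ y$. A Gelfand--Dorfman (GD) algebra is a triple $(A,\circ,[\cdot,\cdot])$ such that $(A,\circ)$ is a Novikov algebra, $(A,[\cdot,\cdot])$ is a Lie algebra, and for all $x,y,z\in A$: $[x,y\circ z]-[z,y\circ x]+[y,x]\circ z-[y,z]\circ x-y\circ[x,z]=0$. The lower central series of $A$ is $A^{\langle1\rangle}=A$, $A^{\langle n+1\rangle}=\sum_{i=1}^n\bigl(A^{\langle i\rangle}\circ A^{\langle n+1-i\rangle}+[A^{\langle i\rangle},A^{\langle n+1-i\rangle}]\bigr)$ (linear spans); $A$ is nilpotent if $A^{\langle N\rangle}=0$ for some $N\ge1$. For $x\in A$ let $L_x(a)=x\circ a$, $R_x(a)=a\circ x$, $\operatorname{ad}_x(a)=[x,a]$. The multiplication algebra $\mathcal M(A)$ is the non-unital associative subalgebra of $\operatorname{End}_{\Bbbk}(A)$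 generated by all $L_x,R_x,\operatorname{ad}_x$, $x\in A$. $\mathcal I_{R\operatorname{ad}}$ is the two-sided ideal of $\mathcal M(A)$ generated by all operators $R_x\operatorname{ad}_y$ (composition), $x,y\in A$. *)

theory Defs
  imports "HOL-Computational_Algebra.Polynomial"
begin

text \<open>The carrier of an algebra is the whole type \<open>'a\<close>; the ground field acts through \<open>scale\<close>.\<close>

locale bilinear_product = vector_space scale
  for scale :: "'k::field \<Rightarrow> 'a::ab_group_add \<Rightarrow> 'a" (infixr \<open>*s\<close> 75) +
  fixes prd :: "'a \<Rightarrow> 'a \<Rightarrow> 'a"
  assumes linear_left: "Vector_Spaces.linear scale scale (\<lambda>x. prd x y)"
    and linear_right: "Vector_Spaces.linear scale scale (\<lambda>y. prd x y)"

locale novikov_algebra = bilinear_product scale mul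
  for scale :: "'k::field \<Rightarrow> 'a::ab_group_add \<Rightarrow> 'a" (infixr \<open>*s\<close> 75)
    and mul :: "'a \<Rightarrow> 'a \<Rightarrow> 'a" (infixl \<open>\<odot>\<close> 70) +
  assumes left_symmetric:
      "(x \<odot> y) \<odot> z - x \<odot> (y \<odot> z) = (y \<odot> x) \<odot> z - y \<odot> (x \<odot> z)"
    and right_commutative: "(x \<odot> y) \<odot> z = (x \<odot> z) \<odot> y"

locale lie_algebra = bilinear_product scale brk
  for scale :: "'k::field \<Rightarrow> 'a::ab_group_add \<Rightarrow> 'a" (infixr \<open>*s\<close> 75)
    and brk :: "'a \<Rightarrow> 'a \<Rightarrow> 'a" (\<open>\<lbrace>_, _\<rbrace>\<close>) +
  assumes alternating: "\<lbrace>x, x\<rbrace> = 0"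
    and jacobi: "\<lbrace>x, \<lbrace>y, z\<rbrace>\<rbrace> + \<lbrace>y, \<lbrace>z, x\<rbrace>\<rbrace> + \<lbrace>z, \<lbrace>x, y\<rbrace>\<rbrace> = 0"

locale gd_algebra = novikov_algebra scale mul + lie_algebra scale brk
  for scale :: "'k::field \<Rightarrow> 'a::ab_group_add \<Rightarrow> 'a" (infixr \<open>*s\<close> 75)
    and mul :: "'a \<Rightarrow> 'a \<Rightarrow> 'a" (infixl \<open>\<odot>\<close> 70)
    and brk :: "'a \<Rightarrow> 'a \<Rightarrow> 'a" (\<open>\<lbrace>_, _\<rbrace>\<close>) +
  assumes gd_compatible:
    "\<lbrace>x, y \<odot> z\<rbrace> - \<lbrace>z, y \<odot> x\<rbrace> + \<lbrace>y, x\<rbrace> \<odot> z - \<lbrace>y, z\<rbrace> \<odot> x - y \<odot> \<lbrace>x, z\<rbrace> = 0"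

definition nilpotent_op :: "('a::zero \<Rightarrow> 'a) \<Rightarrow> bool" where
  "nilpotent_op T \<longleftrightarrow> (\<exists>n. T ^^ n = (\<lambda>_. 0))"

context gd_algebra
begin

definition L :: "'a \<Rightarrow> 'a \<Rightarrow> 'a" where "L x = (\<lambda>a. x \<odot> a)"
definition R :: "'a \<Rightarrow> 'a \<Rightarrow> 'a" where "R x = (\<lambda>a. a \<odot> x)"
definition ad :: "'a \<Rightarrow> 'a \<Rightarrow> 'a" where "ad x = (\<lambda>a. \<lbrace>x, a\<rbrace>)"

text \<open>The series is indexed from 1; the value at index 0 is a dummy.\<close>

fun lower_central :: "nat \<Rightarrow> 'a set" where
  "lower_central n =
    (if n \<le> 1 then UNIV
     else span (\<Union>i\<in>{1..<n}.
       (\<lambda>(x, y). x \<odot> y) ` (lower_central i \<times> lower_central (n - i)) \<union>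
       (\<lambda>(x, y). \<lbrace>x, y\<rbrace>) ` (lower_central i \<times> lower_central (n - i))))"

declare lower_central.simps [simp del]

definition nilpotent_gd :: bool where
  "nilpotent_gd \<longleftrightarrow> (\<exists>N\<ge>1. lower_central N = {0})"

text \<open>Multiplication of operators is composition. The algebra is non-unital: the identity
  is not adjoined. The zero operator belongs to it as a scalar multiple.\<close>

inductive_set mult_algebra :: "('a \<Rightarrow> 'a) set" where
  L: "L x \<in> mult_algebra"
| R: "R x \<in> mult_algebra"
| ad: "ad x \<in> mult_algebra"
| add: "S \<in> mult_algebra \<Longrightarrow> T \<in> mult_algebra \<Longrightarrow> (\<lambda>a. S a + T a) \<in> mult_algebra"
| scale: "T \<in> mult_algebra \<Longrightarrow> (\<lambda>a. c *s T a) \<in> mult_algebra"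
| comp: "S \<in> mult_algebra \<Longrightarrow> T \<in> mult_algebra \<Longrightarrow> S \<circ> T \<in> mult_algebra"

text \<open>An ideal of an algebra is a linear subspace. As \<open>mult_algebra\<close> need not contain the identity,
  closure under scalars does not follow from closure under multiplication by \<open>mult_algebra\<close>.\<close>

inductive_set ideal_Rad :: "('a \<Rightarrow> 'a) set" where
  gen: "R x \<circ> ad y \<in> ideal_Rad"
| add: "S \<in> ideal_Rad \<Longrightarrow> T \<in> ideal_Rad \<Longrightarrow> (\<lambda>a. S a + T a) \<in> ideal_Rad"
| scale: "T \<in> ideal_Rad \<Longrightarrow> (\<lambda>a. c *s T a) \<in> ideal_Rad"
| left: "S \<in> mult_algebra \<Longrightarrow> T \<in> ideal_Rad \<Longrightarrow> S \<circ> T \<in> ideal_Rad"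
| right: "T \<in> ideal_Rad \<Longrightarrow> S \<in> mult_algebra \<Longrightarrow> T \<circ> S \<in> ideal_Rad"

lemma ideal_Rad_subset: "ideal_Rad \<subseteq> mult_algebra"
proof
  fix T assume "T \<in> ideal_Rad"
  then show "T \<in> mult_algebra"
    by induction (blast intro: mult_algebra.intros)+
qed

end

end

theory Submission
  imports Defs
begin

text \<open>
  It is enough to find ideals \<open>A = W\<^sub>0 \<supset> W\<^sub>1 \<supset> \<dots> \<supset> W\<^sub>d = 0\<close> such that every
  operator \<open>L\<^sub>x\<close>, \<open>R\<^sub>x\<close>, \<open>ad\<^sub>x\<close> maps \<open>W\<^sub>i\<close> into \<open>W\<^sub>i\<^sub>+\<^sub>1\<close>: then \<open>A\<^sup>\<langle>\<^sup>n\<^sup>\<rangle> \<subseteq> W\<^sub>i\<close> for \<open>n \<ge> 2\<^sup>i\<close>, because in a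
  product of total length \<open>n\<close> one factor has length at least \<open>n / 2\<close>. Choose \<open>W\<^sub>i\<^sub>+\<^sub>1\<close> maximal among
  the ideals properly contained in \<open>W\<^sub>i\<close>. It remains to show that \<open>A\<close> acts by zero on such a chief
  factor \<open>V = W / U\<close>, whose only invariant subspaces are \<open>0\<close> and \<open>V\<close>.

  The families \<open>{L\<^sub>x}\<close>, \<open>{R\<^sub>x}\<close>, \<open>{ad\<^sub>x}\<close> and \<open>\<I>\<^sub>R\<^sub>a\<^sub>d\<close> are each closed under commutators and consist of
  nilpotent operators, so Engel's theorem (\<open>engel\<close>) applies to each of them separately, giving
  a common kernel on \<open>V\<close>. The action is then trivial for the following reasons.

  \<^item> The common kernel of the ideal \<open>\<I>\<^sub>R\<^sub>a\<^sub>d\<close> is invariant, so \<open>R\<^sub>x ad\<^sub>y = 0\<close> on \<open>V\<close>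
    (\<open>chief_factor_Rad\<close>).

  \<^item> Now the common kernel of all \<open>R\<^sub>x\<close> is invariant: under \<open>ad\<close> because \<open>R\<^sub>x ad\<^sub>y = 0\<close>, under \<open>L\<close> by
    left symmetry \<open>R\<^sub>z L\<^sub>x = L\<^sub>x R\<^sub>z + R\<^sub>z R\<^sub>x - R\<^sub>x\<^sub>\<circ>\<^sub>z\<close>. So \<open>R\<^sub>x = 0\<close> on \<open>V\<close> (\<open>chief_factor_R\<close>).

  \<^item> With \<open>R = 0\<close> the compatibility law reads \<open>[ad\<^sub>x, L\<^sub>y] = L\<^sub>[\<^sub>x\<^sub>,\<^sub>y\<^sub>] - ad\<^sub>y\<^sub>\<circ>\<^sub>x\<close>. Take \<open>v \<noteq> 0\<close> killed by all \<open>ad\<^sub>x\<close>,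
    and let \<open>P\<close> be the span of the vectors \<open>L\<^sub>x\<^sub>1 \<dots> L\<^sub>x\<^sub>k v\<close> with \<open>k \<ge> 1\<close>. Moving \<open>ad\<^sub>x\<close> to the right
    through such a word leaves only words of length at least one, since the last commutator
    \<open>[ad\<^sub>x, L\<^sub>y] v = L\<^sub>[\<^sub>x\<^sub>,\<^sub>y\<^sub>] v\<close> retains a letter \<open>L\<close>; so \<open>P\<close> is invariant
    (\<open>gd_ideal_left_orbit\<close>). As the \<open>L\<^sub>x\<close> are jointly nilpotent, \<open>P \<noteq> V\<close>, whence \<open>P = 0\<close>
    and \<open>v\<close> is killed by every \<open>L\<^sub>x\<close>, \<open>R\<^sub>x\<close>, \<open>ad\<^sub>x\<close>. The vectors with this property form an
    invariant subspace, so they exhaust \<open>V\<close> (\<open>chief_factor_trivial\<close>).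

  Statements about \<open>W / U\<close> are phrased below as statements about vectors of \<open>W\<close> modulo \<open>U\<close>, so that all
  vectors stay in the carrier of \<open>A\<close>.
\<close>

section \<open>Engel's theorem modulo an invariant subspace\<close>

context finite_dimensional_vector_space
begin

text \<open>
  When \<open>S\<close> preserves \<open>U\<close>, the \<open>k\<close>-th layer is \<open>U\<close> plus the span of the images of all words of length \<open>k\<close> in \<open>S\<close>. So
  \<open>layer S U N \<subseteq> U\<close> says that all words of length \<open>N\<close> in \<open>S\<close> vanish modulo \<open>U\<close>.
\<close>

primrec layer :: "('b \<Rightarrow> 'b) set \<Rightarrow> 'b set \<Rightarrow> nat \<Rightarrow> 'b set" where
  "layer S U 0 = UNIV"
| "layer S U (Suc k) = span (U \<union> (\<Union>s\<in>S. s ` layer S U k))"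

lemma layer_Suc_base: "u \<in> U \<Longrightarrow> u \<in> layer S U (Suc k)"
  by (simp add: span_base)

lemma layer_Suc_image: "s \<in> S \<Longrightarrow> v \<in> layer S U k \<Longrightarrow> s v \<in> layer S U (Suc k)"
  by (auto intro!: span_base)

lemma subspace_layer: "subspace (layer S U k)"
  by (cases k) simp_all

lemma layer_mono: "U \<subseteq> U' \<Longrightarrow> layer S U k \<subseteq> layer S U' k"
proof (induction k)
  case (Suc k)
  then show ?case by (auto intro!: span_mono)
qed simp

lemma layer_Suc_subset:
  assumes "subspace U" and "layer S U' k \<subseteq> U'" and "U \<subseteq> U'"
    and "\<And>s v. s \<in> S \<Longrightarrow> v \<in> U' \<Longrightarrow> s v \<in> U"
  shows "layer S U (Suc k) \<subseteq> U"
proof -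
  have "layer S U k \<subseteq> U'"
    using layer_mono[OF assms(3)] assms(2) by blast
  then have "U \<union> (\<Union>s\<in>S. s ` layer S U k) \<subseteq> U"
    using assms(4) by auto
  then show ?thesis
    using span_minimal[OF _ assms(1)] by simp
qed

text \<open>
  If every vector outside \<open>U\<close> could be moved by some letter to another vector outside \<open>U\<close>, then there
  would be words of any length that are nonzero modulo \<open>U\<close>.
\<close>

lemma ex_common_kernel:
  assumes layer: "layer S U N \<subseteq> U" and "w \<in> W" "w \<notin> U"
    and W: "\<And>s v. s \<in> S \<Longrightarrow> v \<in> W \<Longrightarrow> s v \<in> W"
  shows "\<exists>v\<in>W. v \<notin> U \<and> (\<forall>s\<in>S. s v \<in> U)"
proof (rule ccontr)
  assume no: "\<not> ?thesis"
  have "\<exists>v\<in>W. v \<notin> U \<and> v \<in> layer S U k" for k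
  proof (induction k)
    case 0
    then show ?case using assms(2,3) by auto
  next
    case (Suc k)
    then obtain v where "v \<in> W" "v \<notin> U" "v \<in> layer S U k" by blast
    moreover from this no obtain s where "s \<in> S" "s v \<notin> U" by blast
    ultimately show ?case using W layer_Suc_image by blast
  qed
  with layer show False by blast
qed

text \<open>
  The dual fact, a form of Nakayama's lemma: substituting \<open>W \<subseteq> U + S W\<close> into itself gives
  \<open>W \<subseteq> U + S\<^sup>k W\<close> for all \<open>k\<close>.
\<close>

lemma subset_of_subset_span_image:
  assumes layer: "layer S U N \<subseteq> U"
    and W: "W \<subseteq> span (U \<union> (\<Union>s\<in>S. s ` W))"
  shows "W \<subseteq> U"
proof -
  have "W \<subseteq> layer S U k" for k
  proof (induction k)
    case (Suc k)
    have "span (U \<union> (\<Union>s\<in>S. s ` W)) \<subseteq> layer S U (Suc k)"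
      using Suc by (auto intro!: span_mono)
    with W show ?case by blast
  qed simp
  with layer show ?thesis by blast
qed

lemma nilpotent_op_last_nonmember:
  assumes nil: "nilpotent_op s" and "v \<in> W" "v \<notin> U" "0 \<in> U"
    and W: "\<And>w. w \<in> W \<Longrightarrow> s w \<in> W"
  obtains w where "w \<in> W" "w \<notin> U" "s w \<in> U"
proof (rule ccontr)
  assume "\<not> thesis"
  with that have no: "\<And>w. w \<in> W \<Longrightarrow> w \<notin> U \<Longrightarrow> s w \<notin> U" by blast
  have "(s ^^ n) v \<in> W \<and> (s ^^ n) v \<notin> U" for n
    by (induction n) (use assms(2,3) W no in auto)
  with nil \<open>0 \<in> U\<close> show False
    unfolding nilpotent_op_def by metis
qed

lemma subspace_preimages:
  assumes U: "subspace U"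
    and T: "\<And>t. t \<in> T \<Longrightarrow> Vector_Spaces.linear scale scale t"
  shows "subspace {v. \<forall>t\<in>T. t v \<in> U}"
proof (rule subspaceI)
  fix x y c
  have *: "t 0 = 0" "t (x + y) = t x + t y" "t (c *s x) = c *s t x" if "t \<in> T" for t x y c
  proof -
    interpret t: Vector_Spaces.linear scale scale t by (rule T[OF that])
    show "t 0 = 0" "t (x + y) = t x + t y" "t (c *s x) = c *s t x"
      by (rule t.zero t.add t.scale)+
  qed
  show "0 \<in> {v. \<forall>t\<in>T. t v \<in> U}" using U by (auto simp: * subspace_0)
  show "x \<in> {v. \<forall>t\<in>T. t v \<in> U} \<Longrightarrow> y \<in> {v. \<forall>t\<in>T. t v \<in> U} \<Longrightarrow> x + y \<in> {v. \<forall>t\<in>T. t v \<in> U}"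
    using U by (auto simp: * subspace_add)
  show "x \<in> {v. \<forall>t\<in>T. t v \<in> U} \<Longrightarrow> scale c x \<in> {v. \<forall>t\<in>T. t v \<in> U}"
    using U by (auto simp: * subspace_scale)
qed

lemma dim_strict_mono: "subspace U \<Longrightarrow> subspace W \<Longrightarrow> U \<subset> W \<Longrightarrow> dim U < dim W"
  by (metis dim_psubset span_eq_iff)

text \<open>
  The induction is on the codimension of \<open>U\<close>. Among the common kernels modulo \<open>U\<close> of subsets
  of \<open>S\<close>, let \<open>Q \<noteq> U\<close> have the least dimension and let \<open>T'\<close> be the set of all operators in \<open>S\<close> that
  kill \<open>Q\<close> modulo \<open>U\<close>. By induction \<open>T'\<close> acts nilpotently modulo \<open>Q\<close>, hence modulo \<open>U\<close>. If \<open>T' \<noteq> S\<close>, some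
  \<open>s\<close> outside \<open>T'\<close> normalises \<open>T'\<close>. It maps \<open>Q\<close> to itself and is nilpotent there, so it cuts out of
  \<open>Q\<close> a smaller kernel that is still larger than \<open>U\<close>.
\<close>

theorem engel:
  assumes "subspace U"
    and "\<And>s. s \<in> S \<Longrightarrow> Vector_Spaces.linear scale scale s"
    and "\<And>s. s \<in> S \<Longrightarrow> nilpotent_op s"
    and "\<And>s t. s \<in> S \<Longrightarrow> t \<in> S \<Longrightarrow> (\<lambda>a. s (t a) - t (s a)) \<in> S"
    and "\<And>s u. s \<in> S \<Longrightarrow> u \<in> U \<Longrightarrow> s u \<in> U"
  shows "\<exists>N. layer S U N \<subseteq> U"
  using assms
proof (induction "dim (UNIV :: 'b set) - dim U" arbitrary: S U rule: less_induct)
  case less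
  note U = \<open>subspace U\<close>
  note lin = less.prems(2) and nil = less.prems(3) and comm = less.prems(4) and inv = less.prems(5)
  have larger: "dim (UNIV :: 'b set) - dim X < dim (UNIV :: 'b set) - dim U"
    if "subspace X" "U \<subset> X" for X
    using dim_strict_mono[OF U that] dim_subset[OF subset_UNIV, of X] by linarith
  show ?case
  proof (cases "U = UNIV")
    case True
    then show ?thesis by blast
  next
    case False
    define K where "K T = {v. \<forall>t\<in>T. t v \<in> U}" for T :: "('b \<Rightarrow> 'b) set"
    have subK: "subspace (K T)" if "T \<subseteq> S" for T
      unfolding K_def using subspace_preimages[OF U] lin that by blast
    have UK: "U \<subseteq> K T" if "T \<subseteq> S" for T
      unfolding K_def using inv that by blast
    have "{} \<subseteq> S \<and> K {} \<noteq> U"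
      using False by (simp add: K_def)
    from ex_has_least_nat[of "\<lambda>T. T \<subseteq> S \<and> K T \<noteq> U", OF this, of "\<lambda>T. dim (K T)"]
    obtain T where T: "T \<subseteq> S" "K T \<noteq> U"
      and min: "\<And>T'. T' \<subseteq> S \<Longrightarrow> K T' \<noteq> U \<Longrightarrow> dim (K T) \<le> dim (K T')"
      by (elim exE conjE) simp
    define Q where "Q = K T"
    have Q: "subspace Q" "U \<subset> Q"
      using T subK UK unfolding Q_def by blast+
    define T' where "T' = {s \<in> S. \<forall>v\<in>Q. s v \<in> U}"
    have Q_eq: "Q = {v. \<forall>t\<in>T'. t v \<in> U}"
    proof (intro subset_antisym subsetI CollectI ballI)
      show "t v \<in> U" if "v \<in> Q" "t \<in> T'" for v t
        using that by (simp add: T'_def)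
      have "T \<subseteq> T'"
        using T(1) by (auto simp: T'_def Q_def K_def)
      then show "v \<in> Q" if "v \<in> {v. \<forall>t\<in>T'. t v \<in> U}" for v
        using that by (auto simp: Q_def K_def)
    qed
    have "\<exists>N. layer T' Q N \<subseteq> Q"
    proof (rule less.hyps[OF larger[OF Q] Q(1)])
      fix s assume "s \<in> T'"
      then have s: "s \<in> S" "\<And>v. v \<in> Q \<Longrightarrow> s v \<in> U" by (simp_all add: T'_def)
      show "Vector_Spaces.linear scale scale s" "nilpotent_op s"
        using lin nil s(1) by blast+
      show "s v \<in> Q" if "v \<in> Q" for v
        using s(2)[OF that] Q(2) by blast
      fix t assume "t \<in> T'"
      then have t: "t \<in> S" "\<And>v. v \<in> Q \<Longrightarrow> t v \<in> U" by (simp_all add: T'_def)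
      have "s (t v) - t (s v) \<in> U" if "v \<in> Q" for v
        using subspace_diff[OF U inv[OF s(1) t(2)[OF that]] inv[OF t(1) s(2)[OF that]]] .
      then show "(\<lambda>a. s (t a) - t (s a)) \<in> T'"
        using comm[OF s(1) t(1)] by (simp add: T'_def)
    qed
    then obtain N where "layer T' Q N \<subseteq> Q" ..
    then have N: "layer T' U (Suc N) \<subseteq> U"
      by (rule layer_Suc_subset[OF U]) (use Q(2) in \<open>auto simp: T'_def\<close>)
    have "T' = S"
    proof (rule ccontr)
      assume "T' \<noteq> S"
      \<comment> \<open>Otherwise some sequence of iterated commutators with elements \<open>t\<close> of \<open>T'\<close> never enters \<open>T'\<close>. On
        \<open>Q\<close> only their terms with all \<open>t\<close> on the left are nonzero modulo \<open>U\<close>, so they map \<open>Q\<close>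
        into deeper and deeper layers of \<open>T'\<close>.\<close>
      have "\<exists>s\<in>S - T'. \<forall>t\<in>T'. (\<lambda>a. s (t a) - t (s a)) \<in> T'"
      proof (rule ccontr)
        assume no: "\<not> ?thesis"
        have "\<exists>s\<in>S - T'. \<forall>v\<in>Q. s v \<in> layer T' U k" for k
        proof (induction k)
          case 0
          then show ?case using \<open>T' \<noteq> S\<close> by (auto simp: T'_def)
        next
          case (Suc k)
          then obtain s where s: "s \<in> S - T'" "\<And>v. v \<in> Q \<Longrightarrow> s v \<in> layer T' U k" by blast
          with no obtain t where t: "t \<in> T'" "(\<lambda>a. s (t a) - t (s a)) \<notin> T'" by blast
          have "(\<lambda>a. s (t a) - t (s a)) \<in> S"
            using s(1) t(1) comm by (auto simp: T'_def)
          moreover have "s (t v) - t (s v) \<in> layer T' U (Suc k)" if "v \<in> Q" for v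
          proof (rule subspace_diff[OF subspace_layer])
            have "t v \<in> U" using t(1) that by (auto simp: T'_def)
            then show "s (t v) \<in> layer T' U (Suc k)"
              using inv s(1) by (intro layer_Suc_base) blast
            show "t (s v) \<in> layer T' U (Suc k)"
              using layer_Suc_image t(1) s(2) that by blast
          qed
          ultimately show ?case
            using t(2) by (intro bexI[of _ "\<lambda>a. s (t a) - t (s a)"]) auto
        qed
        from this[of "Suc N"] obtain s where s: "s \<in> S" "s \<notin> T'"
            "\<And>v. v \<in> Q \<Longrightarrow> s v \<in> layer T' U (Suc N)"
          by blast
        with N have "\<And>v. v \<in> Q \<Longrightarrow> s v \<in> U" by blast
        with s(1,2) show False by (simp add: T'_def)
      qed
      then obtain s where s: "s \<in> S" "s \<notin> T'"
        and st: "\<And>t. t \<in> T' \<Longrightarrow> (\<lambda>a. s (t a) - t (s a)) \<in> T'" by blast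
      have sQ: "s v \<in> Q" if "v \<in> Q" for v
      proof -
        have "t (s v) \<in> U" if t: "t \<in> T'" for t
        proof -
          have "s (t v) \<in> U" using inv s(1) t \<open>v \<in> Q\<close> by (auto simp: T'_def)
          moreover have "s (t v) - t (s v) \<in> U"
            using st[OF t] \<open>v \<in> Q\<close> by (auto simp: T'_def)
          ultimately have "s (t v) - (s (t v) - t (s v)) \<in> U"
            by (rule subspace_diff[OF U])
          then show ?thesis by simp
        qed
        then show ?thesis by (simp add: Q_eq)
      qed
      obtain v where "v \<in> Q" "v \<notin> U" using Q(2) by blast
      then obtain w where w: "w \<in> Q" "w \<notin> U" "s w \<in> U"
        using nilpotent_op_last_nonmember[OF nil[OF s(1)] _ _ subspace_0[OF U] sQ] by blast
      let ?T = "insert s T'"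
      have sub: "?T \<subseteq> S" using s(1) by (auto simp: T'_def)
      have "w \<in> K ?T" using w by (auto simp: K_def Q_eq)
      then have "dim Q \<le> dim (K ?T)"
        using min[OF sub] w(2) unfolding Q_def by blast
      moreover have "K ?T \<subset> Q"
      proof (intro psubsetI subsetI notI)
        show "v \<in> Q" if "v \<in> K ?T" for v
          using that by (simp add: K_def Q_eq)
        obtain v where "v \<in> Q" "s v \<notin> U" using s by (auto simp: T'_def)
        moreover assume "K ?T = Q"
        ultimately show False by (auto simp: K_def)
      qed
      ultimately show False
        using dim_strict_mono[OF subK[OF sub] Q(1)] by simp
    qed
    with N show ?thesis by blast
  qed
qed

end


section \<open>Operators and chief factors of a GD algebra\<close>

locale finite_dimensional_gd_algebra =
  gd_algebra scale mul brk + finite_dimensional_vector_space scale Basis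
  for scale :: "'k::field \<Rightarrow> 'a::ab_group_add \<Rightarrow> 'a" (infixr \<open>*s\<close> 75)
    and mul :: "'a \<Rightarrow> 'a \<Rightarrow> 'a" (infixl \<open>\<odot>\<close> 70)
    and brk :: "'a \<Rightarrow> 'a \<Rightarrow> 'a" (\<open>\<lbrace>_, _\<rbrace>\<close>)
    and Basis :: "'a set"
begin

definition gd_ideal :: "'a set \<Rightarrow> bool" where
  "gd_ideal W \<longleftrightarrow> subspace W \<and> (\<forall>x. \<forall>w\<in>W. x \<odot> w \<in> W \<and> w \<odot> x \<in> W \<and> \<lbrace>x, w\<rbrace> \<in> W)"

lemma gd_idealD:
  assumes "gd_ideal W"
  shows "subspace W" and "w \<in> W \<Longrightarrow> x \<odot> w \<in> W" and "w \<in> W \<Longrightarrow> w \<odot> x \<in> W"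
    and "w \<in> W \<Longrightarrow> \<lbrace>x, w\<rbrace> \<in> W"
  using assms by (auto simp: gd_ideal_def)

lemma linear_L: "Vector_Spaces.linear scale scale (L x)"
  unfolding L_def by (rule bilinear_product.linear_right[OF novikov_algebra.axioms(1)[OF novikov_algebra_axioms]])

lemma linear_R: "Vector_Spaces.linear scale scale (R x)"
  unfolding R_def by (rule bilinear_product.linear_left[OF novikov_algebra.axioms(1)[OF novikov_algebra_axioms]])

lemma linear_ad: "Vector_Spaces.linear scale scale (ad x)"
  unfolding ad_def by (rule linear_right)


lemma mul_zero_right: "x \<odot> 0 = 0"
proof -
  interpret l: Vector_Spaces.linear scale scale "L x" by (rule linear_L)
  show ?thesis using l.zero by (simp add: L_def)
qed

lemma mul_zero_left: "0 \<odot> x = 0" and mul_diff_left: "(y - z) \<odot> x = y \<odot> x - z \<odot> x"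
proof -
  interpret r: Vector_Spaces.linear scale scale "R x" by (rule linear_R)
  show "0 \<odot> x = 0" "(y - z) \<odot> x = y \<odot> x - z \<odot> x"
    using r.zero r.diff by (simp_all add: R_def)
qed

lemma brk_zero_right: "\<lbrace>x, 0\<rbrace> = 0" and brk_uminus_right: "\<lbrace>x, - y\<rbrace> = - \<lbrace>x, y\<rbrace>"
proof -
  interpret l: Vector_Spaces.linear scale scale "ad x" by (rule linear_ad)
  show "\<lbrace>x, 0\<rbrace> = 0" "\<lbrace>x, - y\<rbrace> = - \<lbrace>x, y\<rbrace>"
    using l.zero l.neg by (simp_all add: ad_def)
qed

lemma brk_skew: "\<lbrace>y, x\<rbrace> = - \<lbrace>x, y\<rbrace>"
proof -
  interpret r: Vector_Spaces.linear scale scale "\<lambda>u. \<lbrace>u, x + y\<rbrace>" by (rule linear_left)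
  interpret lx: Vector_Spaces.linear scale scale "\<lambda>u. \<lbrace>x, u\<rbrace>" by (rule linear_right)
  interpret ly: Vector_Spaces.linear scale scale "\<lambda>u. \<lbrace>y, u\<rbrace>" by (rule linear_right)
  have "\<lbrace>x + y, x + y\<rbrace> = \<lbrace>x, x\<rbrace> + \<lbrace>x, y\<rbrace> + (\<lbrace>y, x\<rbrace> + \<lbrace>y, y\<rbrace>)"
    by (simp only: r.add lx.add ly.add)
  then have "\<lbrace>y, x\<rbrace> + \<lbrace>x, y\<rbrace> = 0" by (simp add: alternating add.commute)
  then show ?thesis by (simp only: eq_neg_iff_add_eq_0)
qed

lemma L_commutator: "(\<lambda>a. L x (L y a) - L y (L x a)) = L (x \<odot> y - y \<odot> x)"
proof
  show "L x (L y a) - L y (L x a) = L (x \<odot> y - y \<odot> x) a" for a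
    using left_symmetric[of x y a] by (simp add: L_def mul_diff_left algebra_simps)
qed

lemma R_commutator: "(\<lambda>a. R x (R y a) - R y (R x a)) = R 0"
proof
  show "R x (R y a) - R y (R x a) = R 0 a" for a
    using right_commutative[of a x y] by (simp add: R_def mul_zero_right)
qed

lemma ad_commutator: "(\<lambda>a. ad x (ad y a) - ad y (ad x a)) = ad \<lbrace>x, y\<rbrace>"
proof
  fix a
  have "\<lbrace>y, \<lbrace>a, x\<rbrace>\<rbrace> = - \<lbrace>y, \<lbrace>x, a\<rbrace>\<rbrace>" "\<lbrace>a, \<lbrace>x, y\<rbrace>\<rbrace> = - \<lbrace>\<lbrace>x, y\<rbrace>, a\<rbrace>"
    by (metis brk_skew brk_uminus_right, rule brk_skew)
  then show "ad x (ad y a) - ad y (ad x a) = ad \<lbrace>x, y\<rbrace> a"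
    using jacobi[of x y a] by (simp add: ad_def algebra_simps)
qed

text \<open>
  The compatibility law solved for the bracket with a product. Read as a statement about
  operators applied to \<open>v\<close>, it expresses \<open>[ad\<^sub>x, L\<^sub>y]\<close> through \<open>R\<^sub>x ad\<^sub>y\<close>, \<open>L\<^sub>[\<^sub>x\<^sub>,\<^sub>y\<^sub>]\<close> and \<open>ad\<^sub>y\<^sub>\<circ>\<^sub>x\<close>.
\<close>

lemma brk_mul:
  "\<lbrace>x, y \<odot> v\<rbrace> = \<lbrace>y, v\<rbrace> \<odot> x + y \<odot> \<lbrace>x, v\<rbrace> - \<lbrace>y, x\<rbrace> \<odot> v - \<lbrace>y \<odot> x, v\<rbrace>"
  using gd_compatible[of x y v] brk_skew[of v "y \<odot> x"] by (simp add: algebra_simps)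

lemma linear_mult_algebra: "T \<in> mult_algebra \<Longrightarrow> Vector_Spaces.linear scale scale T"
proof (induction rule: mult_algebra.induct)
  case (L x)
  then show ?case by (rule linear_L)
next
  case (R x)
  then show ?case by (rule linear_R)
next
  case (ad x)
  then show ?case by (rule linear_ad)
next
  case (add S T)
  then show ?case by (simp add: Vector_Spaces.linear_iff scale_right_distrib)
next
  case (scale T c)
  then show ?case by (simp add: Vector_Spaces.linear_iff scale_right_distrib mult.commute)
next
  case (comp S T)
  then show ?case by (simp add: Vector_Spaces.linear_iff)
qed

lemma mult_algebra_ideal:
  assumes U: "gd_ideal U"
  shows "T \<in> mult_algebra \<Longrightarrow> u \<in> U \<Longrightarrow> T u \<in> U"
proof (induction arbitrary: u rule: mult_algebra.induct)
  case (add S T)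
  then show ?case using subspace_add[OF gd_idealD(1)[OF U]] by simp
next
  case (scale T c)
  then show ?case using subspace_scale[OF gd_idealD(1)[OF U]] by simp
qed (use gd_idealD[OF U] in \<open>simp_all add: L_def R_def ad_def\<close>)

lemma ideal_Rad_commutator:
  assumes "S \<in> ideal_Rad" "T \<in> ideal_Rad"
  shows "(\<lambda>a. S (T a) - T (S a)) \<in> ideal_Rad"
proof -
  have "S \<circ> T \<in> ideal_Rad" "T \<circ> S \<in> ideal_Rad"
    using assms ideal_Rad_subset ideal_Rad.left by blast+
  then have "(\<lambda>a. (S \<circ> T) a + (- 1) *s (T \<circ> S) a) \<in> ideal_Rad"
    by (intro ideal_Rad.add ideal_Rad.scale)
  then show ?thesis by simp
qed

definition chief_factor :: "'a set \<Rightarrow> 'a set \<Rightarrow> bool" where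
  "chief_factor U W \<longleftrightarrow> gd_ideal U \<and> gd_ideal W \<and> U \<subset> W \<and>
     (\<forall>V. gd_ideal V \<longrightarrow> U \<subseteq> V \<longrightarrow> V \<subseteq> W \<longrightarrow> V = U \<or> V = W)"

lemma ex_chief_factor:
  assumes W: "gd_ideal W" "W \<noteq> {0}"
  shows "\<exists>U. chief_factor U W"
proof -
  have "gd_ideal {0}"
    by (simp add: gd_ideal_def mul_zero_left mul_zero_right brk_zero_right)
  moreover have "{0} \<subset> W"
    using W subspace_0[OF gd_idealD(1)[OF W(1)]] by auto
  ultimately have "gd_ideal {0} \<and> {0} \<subset> W" by simp
  moreover have "\<forall>U. gd_ideal U \<and> U \<subset> W \<longrightarrow> dim U < Suc (dim W)"
    using dim_strict_mono gd_idealD(1) W(1) less_SucI by blast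
  ultimately have "\<exists>U. (gd_ideal U \<and> U \<subset> W) \<and> (\<forall>V. gd_ideal V \<and> V \<subset> W \<longrightarrow> dim V \<le> dim U)"
    by (rule ex_has_greatest_nat)
  then obtain U where U: "gd_ideal U" "U \<subset> W"
    and max: "\<And>V. gd_ideal V \<Longrightarrow> V \<subset> W \<Longrightarrow> dim V \<le> dim U"
    by blast
  have "V = U \<or> V = W" if V: "gd_ideal V" "U \<subseteq> V" "V \<subseteq> W" for V
  proof (rule ccontr)
    assume "\<not> ?thesis"
    then have "V \<subset> W" "U \<subset> V" using V by auto
    with max[OF V(1)] dim_strict_mono[OF gd_idealD(1)[OF U(1)] gd_idealD(1)[OF V(1)]]
    show False by simp
  qed
  with U W(1) show ?thesis unfolding chief_factor_def by blast
qed

text \<open>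
  Schur's argument: once the common kernel of \<open>S\<close> on \<open>W / U\<close> is known to be invariant and nonzero, it is
  everything.
\<close>

lemma chief_factor_annihilated:
  assumes cf: "chief_factor U W"
    and S: "S \<subseteq> mult_algebra"
    and v: "v \<in> W" "v \<notin> U" "\<And>s. s \<in> S \<Longrightarrow> s v \<in> U"
    and closed: "\<And>w s x. w \<in> W \<Longrightarrow> (\<And>t. t \<in> S \<Longrightarrow> t w \<in> U) \<Longrightarrow> s \<in> S \<Longrightarrow>
      s (x \<odot> w) \<in> U \<and> s (w \<odot> x) \<in> U \<and> s \<lbrace>x, w\<rbrace> \<in> U"
    and "s \<in> S" "w \<in> W"
  shows "s w \<in> U"
proof -
  have U: "gd_ideal U" and W: "gd_ideal W" and "U \<subset> W"
    and simple: "\<And>V. gd_ideal V \<Longrightarrow> U \<subseteq> V \<Longrightarrow> V \<subseteq> W \<Longrightarrow> V = U \<or> V = W"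
    using cf unfolding chief_factor_def by blast+
  define V where "V = W \<inter> {w. \<forall>s\<in>S. s w \<in> U}"
  have "subspace V"
    unfolding V_def using S linear_mult_algebra gd_idealD(1)[OF U] gd_idealD(1)[OF W]
    by (intro subspace_inter subspace_preimages) auto
  then have "gd_ideal V"
    unfolding gd_ideal_def using gd_idealD(2-4)[OF W] closed by (auto simp: V_def)
  moreover have "U \<subseteq> V"
    unfolding V_def using \<open>U \<subset> W\<close> mult_algebra_ideal[OF U] S by auto
  moreover have "v \<in> V" using v by (simp add: V_def)
  ultimately have "V = W" using simple[of V] v(2) by (auto simp: V_def)
  then show ?thesis using \<open>s \<in> S\<close> \<open>w \<in> W\<close> by (auto simp: V_def)
qed

text \<open>
  This is \<open>U\<close> plus the span of all \<open>L\<^sub>x\<^sub>1 \<dots> L\<^sub>x\<^sub>k v\<close> with \<open>k \<ge> 1\<close>. The empty word is left out, since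
  the aim is to separate \<open>v\<close> from this subspace.
\<close>

inductive_set left_orbit :: "'a set \<Rightarrow> 'a \<Rightarrow> 'a set" for U v where
  base: "u \<in> U \<Longrightarrow> u \<in> left_orbit U v"
| start: "x \<odot> v \<in> left_orbit U v"
| add: "p \<in> left_orbit U v \<Longrightarrow> q \<in> left_orbit U v \<Longrightarrow> p + q \<in> left_orbit U v"
| scale: "p \<in> left_orbit U v \<Longrightarrow> c *s p \<in> left_orbit U v"
| left: "p \<in> left_orbit U v \<Longrightarrow> x \<odot> p \<in> left_orbit U v"

lemma subspace_left_orbit: "subspace U \<Longrightarrow> subspace (left_orbit U v)"
  by (rule subspaceI) (blast intro: left_orbit.base left_orbit.add left_orbit.scale subspace_0)+

lemma left_orbit_subset:
  assumes "gd_ideal W" "U \<subseteq> W" "v \<in> W"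
  shows "left_orbit U v \<subseteq> W"
proof
  show "p \<in> W" if "p \<in> left_orbit U v" for p
    using that
  proof induction
    case (base u)
    then show ?case using assms(2) by blast
  next
    case (start x)
    then show ?case using gd_idealD(2)[OF assms(1)] assms(3) by blast
  next
    case (add p q)
    then show ?case using subspace_add[OF gd_idealD(1)[OF assms(1)]] by blast
  next
    case (scale p c)
    then show ?case using subspace_scale[OF gd_idealD(1)[OF assms(1)]] by blast
  next
    case (left p x)
    then show ?case using gd_idealD(2)[OF assms(1)] by blast
  qed
qed

text \<open>
  Invariance under \<open>ad\<close> is the point. In the expansion of \<open>\<lbrace>x, y \<odot> p\<rbrace>\<close> the first term lies in \<open>U\<close>
  because \<open>R\<close> vanishes on \<open>W / U\<close>. Of the others, one is a left multiple of \<open>p\<close>, and two contain the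
  bracket of some element with the shorter word \<open>p\<close>, which lies in the orbit by induction, and for
  \<open>p = v\<close> even in \<open>U\<close>. The same computation therefore serves for words of length one and for longer
  words.
\<close>

lemma gd_ideal_left_orbit:
  assumes U: "gd_ideal U" and W: "gd_ideal W" and "U \<subseteq> W" "v \<in> W"
    and R: "\<And>w x. w \<in> W \<Longrightarrow> w \<odot> x \<in> U"
    and ad: "\<And>x. \<lbrace>x, v\<rbrace> \<in> U"
  shows "gd_ideal (left_orbit U v)"
proof -
  let ?P = "left_orbit U v"
  have P: "subspace ?P" by (rule subspace_left_orbit[OF gd_idealD(1)[OF U]])
  have PW: "?P \<subseteq> W" by (rule left_orbit_subset[OF W assms(3,4)])
  have step: "\<lbrace>x, y \<odot> p\<rbrace> \<in> ?P"
    if "p \<in> W" "\<And>x. \<lbrace>x, p\<rbrace> \<in> ?P" "\<And>x. x \<odot> p \<in> ?P" for x y p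
  proof -
    have "\<lbrace>y, p\<rbrace> \<odot> x \<in> ?P"
      by (rule left_orbit.base[OF R[OF gd_idealD(4)[OF W that(1)]]])
    moreover have "y \<odot> \<lbrace>x, p\<rbrace> \<in> ?P"
      by (rule left_orbit.left[OF that(2)])
    ultimately show ?thesis
      unfolding brk_mul[of x y p]
      by (rule subspace_diff[OF P subspace_diff[OF P left_orbit.add that(3)] that(2)])
  qed
  have brk: "\<lbrace>x, p\<rbrace> \<in> ?P" if "p \<in> ?P" for x p
    using that
  proof (induction arbitrary: x)
    case (base u)
    then show ?case using gd_idealD(4)[OF U] left_orbit.base by blast
  next
    case (start y)
    then show ?case
      by (rule step[OF \<open>v \<in> W\<close> left_orbit.base[OF ad] left_orbit.start])
  next
    case (add p q)
    interpret l: Vector_Spaces.linear scale scale "brk x" by (rule linear_right)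
    show ?case using add by (simp add: l.add left_orbit.add)
  next
    case (scale p c)
    interpret l: Vector_Spaces.linear scale scale "brk x" by (rule linear_right)
    show ?case using scale by (simp add: l.scale left_orbit.scale)
  next
    case (left p y)
    from PW left.hyps have "p \<in> W" by blast
    then show ?case by (rule step[OF _ left.IH left_orbit.left[OF left.hyps]])
  qed
  show ?thesis
    unfolding gd_ideal_def
  proof (intro conjI allI ballI P brk)
    show "x \<odot> p \<in> ?P" if "p \<in> ?P" for x p
      using that by (rule left_orbit.left)
    show "p \<odot> x \<in> ?P" if "p \<in> ?P" for x p
      using PW that by (intro left_orbit.base R) blast
  qed
qed

end

section \<open>Triviality of the action on chief factors\<close>

locale nil_gd_algebra = finite_dimensional_gd_algebra +
  assumes nil_ad: "nilpotent_op (ad x)"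
    and nil_L: "nilpotent_op (L x)"
    and nil_R: "nilpotent_op (R x)"
    and nil_ideal_Rad: "T \<in> ideal_Rad \<Longrightarrow> nilpotent_op T"
begin

lemma layers_vanish:
  assumes U: "gd_ideal U" and S: "S \<in> {range L, range R, range ad, ideal_Rad}"
  shows "\<exists>N. layer S U N \<subseteq> U"
proof (rule engel[OF gd_idealD(1)[OF U]])
  have sub: "s \<in> mult_algebra" if "s \<in> S" for s
    using S that ideal_Rad_subset by (auto intro: mult_algebra.intros)
  show "Vector_Spaces.linear scale scale s" if "s \<in> S" for s
    using sub[OF that] by (rule linear_mult_algebra)
  show "s u \<in> U" if "s \<in> S" "u \<in> U" for s u
    using sub[OF that(1)] that(2) by (rule mult_algebra_ideal[OF U])
  show "nilpotent_op s" if "s \<in> S" for s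
    using that S nil_ad nil_L nil_R nil_ideal_Rad by auto
  show "(\<lambda>a. s (t a) - t (s a)) \<in> S" if "s \<in> S" "t \<in> S" for s t
    using that S L_commutator R_commutator ad_commutator ideal_Rad_commutator by auto
qed

lemma ex_killed_vector:
  assumes cf: "chief_factor U W" and S: "S \<in> {range L, range R, range ad, ideal_Rad}"
  shows "\<exists>v\<in>W. v \<notin> U \<and> (\<forall>s\<in>S. s v \<in> U)"
proof -
  have U: "gd_ideal U" and W: "gd_ideal W" and "U \<subset> W"
    using cf unfolding chief_factor_def by blast+
  obtain w where "w \<in> W" "w \<notin> U" using \<open>U \<subset> W\<close> by blast
  moreover obtain N where "layer S U N \<subseteq> U" using layers_vanish[OF U S] ..
  moreover have "s \<in> mult_algebra" if "s \<in> S" for s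
    using S that ideal_Rad_subset by (auto intro: mult_algebra.intros)
  ultimately show ?thesis
    using mult_algebra_ideal[OF W] by (intro ex_common_kernel) auto
qed

text \<open>
  The common kernel of \<open>\<I>\<^sub>R\<^sub>a\<^sub>d\<close> is invariant because \<open>\<I>\<^sub>R\<^sub>a\<^sub>d\<close> absorbs multiplication operators on the right.
\<close>

lemma chief_factor_Rad:
  assumes cf: "chief_factor U W" and "w \<in> W"
  shows "\<lbrace>y, w\<rbrace> \<odot> x \<in> U"
proof -
  obtain v where v: "v \<in> W" "v \<notin> U" "\<forall>s\<in>ideal_Rad. s v \<in> U"
    using ex_killed_vector[OF cf, of "ideal_Rad"] by auto
  have "(R x \<circ> ad y) w \<in> U"
  proof (rule chief_factor_annihilated[OF cf ideal_Rad_subset v(1,2) _ _ ideal_Rad.gen \<open>w \<in> W\<close>])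
    fix w s x assume w: "\<And>t. t \<in> ideal_Rad \<Longrightarrow> t w \<in> U" and s: "s \<in> ideal_Rad"
    have "s \<circ> m \<in> ideal_Rad" if "m \<in> mult_algebra" for m
      using s that by (rule ideal_Rad.right)
    then have "(s \<circ> L x) w \<in> U" "(s \<circ> R x) w \<in> U" "(s \<circ> ad x) w \<in> U"
      by (blast intro: w mult_algebra.intros)+
    then show "s (x \<odot> w) \<in> U \<and> s (w \<odot> x) \<in> U \<and> s \<lbrace>x, w\<rbrace> \<in> U"
      by (simp add: L_def R_def ad_def)
  qed (use v(3) in blast)
  then show ?thesis by (simp add: R_def ad_def)
qed

text \<open>
  On the common kernel of the right multiplications, left symmetry turns \<open>R\<^sub>z L\<^sub>x\<close> into an expression
  in right multiplications alone, and \<open>R\<^sub>z ad\<^sub>x\<close> already vanishes.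
\<close>

lemma chief_factor_R:
  assumes cf: "chief_factor U W" and "w \<in> W"
  shows "w \<odot> x \<in> U"
proof -
  have U: "gd_ideal U" using cf unfolding chief_factor_def by blast
  obtain v where v: "v \<in> W" "v \<notin> U" "\<forall>s\<in>range R. s v \<in> U"
    using ex_killed_vector[OF cf, of "range R"] by auto
  have "R x w \<in> U"
  proof (rule chief_factor_annihilated[OF cf _ v(1,2) _ _ rangeI[of R x] \<open>w \<in> W\<close>])
    show "range R \<subseteq> mult_algebra" by (auto intro: mult_algebra.intros)
    fix w s x assume "w \<in> W" and w: "\<And>t. t \<in> range R \<Longrightarrow> t w \<in> U" and "s \<in> range R"
    then obtain z where s: "s = R z" by blast
    have w: "w \<odot> y \<in> U" for y using w[of "R y"] by (simp add: R_def)
    have "(x \<odot> w) \<odot> z = x \<odot> (w \<odot> z) + (w \<odot> x) \<odot> z - w \<odot> (x \<odot> z)"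
      using left_symmetric[of x w z] by (simp add: algebra_simps)
    then have "(x \<odot> w) \<odot> z \<in> U"
      using gd_idealD[OF U] w by (simp add: subspace_add subspace_diff)
    then show "s (x \<odot> w) \<in> U \<and> s (w \<odot> x) \<in> U \<and> s \<lbrace>x, w\<rbrace> \<in> U"
      using chief_factor_Rad[OF cf \<open>w \<in> W\<close>] gd_idealD(3)[OF U] w by (simp add: s R_def)
  qed (use v(3) in blast)
  then show ?thesis by (simp add: R_def)
qed

text \<open>
  A vector \<open>v\<close> killed by \<open>ad\<close> has an orbit under nonempty words in the \<open>L\<^sub>x\<close> that is an ideal. It is not
  all of \<open>W\<close>, because then \<open>W\<close> would be its own image under the jointly nilpotent \<open>L\<^sub>x\<close> modulo \<open>U\<close>.
  Hence the orbit is \<open>U\<close>.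
\<close>

lemma ex_vector_killed_by_L_ad:
  assumes cf: "chief_factor U W"
  obtains v where "v \<in> W" "v \<notin> U" "\<And>x. x \<odot> v \<in> U" "\<And>x. \<lbrace>x, v\<rbrace> \<in> U"
proof -
  have U: "gd_ideal U" and W: "gd_ideal W" and UW: "U \<subset> W" "U \<subseteq> W"
    and simple: "\<And>V. gd_ideal V \<Longrightarrow> U \<subseteq> V \<Longrightarrow> V \<subseteq> W \<Longrightarrow> V = U \<or> V = W"
    using cf unfolding chief_factor_def by blast+
  obtain v where v: "v \<in> W" "v \<notin> U" and "\<forall>s\<in>range ad. s v \<in> U"
    using ex_killed_vector[OF cf, of "range ad"] by auto
  then have ad: "\<lbrace>x, v\<rbrace> \<in> U" for x by (auto simp: ad_def)
  let ?P = "left_orbit U v"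
  have "gd_ideal ?P"
    by (rule gd_ideal_left_orbit[OF U W UW(2) v(1) chief_factor_R[OF cf] ad])
  moreover have PW: "?P \<subseteq> W" by (rule left_orbit_subset[OF W UW(2) v(1)])
  moreover have "?P \<noteq> W"
  proof
    assume "?P = W"
    have "p \<in> span (U \<union> (\<Union>s\<in>range L. s ` W))" if "p \<in> ?P" for p
      using that
    proof induction
      case (start x)
      then show ?case using v(1) by (intro span_base) (auto simp: L_def)
    next
      case (left p x)
      then show ?case using PW by (intro span_base) (auto simp: L_def)
    qed (simp_all add: span_base span_add span_scale)
    then have "W \<subseteq> span (U \<union> (\<Union>s\<in>range L. s ` W))" using \<open>?P = W\<close> by blast
    moreover obtain N where "layer (range L) U N \<subseteq> U" using layers_vanish[OF U, of "range L"] by blast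
    ultimately have "W \<subseteq> U" by (rule subset_of_subset_span_image[rotated])
    with UW(1) show False by blast
  qed
  ultimately have "?P = U" using simple left_orbit.base by blast
  then have "x \<odot> v \<in> U" for x using left_orbit.start by blast
  with that v ad show thesis by blast
qed

lemma chief_factor_trivial:
  assumes cf: "chief_factor U W" and "w \<in> W"
  shows "x \<odot> w \<in> U" and "\<lbrace>x, w\<rbrace> \<in> U"
proof -
  have U: "gd_ideal U" using cf unfolding chief_factor_def by blast
  obtain v where v: "v \<in> W" "v \<notin> U" "\<And>x. x \<odot> v \<in> U" "\<And>x. \<lbrace>x, v\<rbrace> \<in> U"
    using ex_vector_killed_by_L_ad[OF cf] by blast
  have sub: "range L \<union> range ad \<subseteq> mult_algebra" by (auto intro: mult_algebra.intros)
  have killed: "s w \<in> U" if "s \<in> range L \<union> range ad" for s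
  proof (rule chief_factor_annihilated[OF cf sub v(1,2) _ _ that \<open>w \<in> W\<close>])
    show "s v \<in> U" if "s \<in> range L \<union> range ad" for s
      using that v(3,4) by (auto simp: L_def ad_def)
    fix w s x assume "w \<in> W" and w: "\<And>t. t \<in> range L \<union> range ad \<Longrightarrow> t w \<in> U"
      and s: "s \<in> range L \<union> range ad"
    have "L x w \<in> U" "ad x w \<in> U" using w by blast+
    moreover have "w \<odot> x \<in> U" using chief_factor_R[OF cf \<open>w \<in> W\<close>] .
    moreover have "s u \<in> U" if "u \<in> U" for u
      using mult_algebra_ideal[OF U] s sub that by blast
    ultimately show "s (x \<odot> w) \<in> U \<and> s (w \<odot> x) \<in> U \<and> s \<lbrace>x, w\<rbrace> \<in> U"
      by (simp add: L_def ad_def)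
  qed
  show "x \<odot> w \<in> U" "\<lbrace>x, w\<rbrace> \<in> U"
    using killed[of "L x"] killed[of "ad x"] by (simp_all add: L_def ad_def)
qed

section \<open>Descent along a chief series\<close>

text \<open>
  In a product of total length at least \<open>2 * m\<close> one of the two factors has length at least \<open>m\<close>, so it
  lies in \<open>W\<close>, and multiplication by anything moves it into \<open>U\<close>.
\<close>

lemma lower_central_descends:
  assumes cf: "chief_factor U W" and m: "m \<ge> 1" "\<And>n. n \<ge> m \<Longrightarrow> lower_central n \<subseteq> W"
    and n: "n \<ge> 2 * m"
  shows "lower_central n \<subseteq> U"
proof -
  have U: "gd_ideal U" using cf unfolding chief_factor_def by blast
  have prd: "x \<odot> y \<in> U \<and> \<lbrace>x, y\<rbrace> \<in> U"
    if "i \<in> {1..<n}" "x \<in> lower_central i" "y \<in> lower_central (n - i)" for i x y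
  proof -
    from n have "i \<ge> m \<or> n - i \<ge> m" by linarith
    then show ?thesis
    proof
      assume "i \<ge> m"
      then have x: "x \<in> W" using m that(2) by blast
      have "\<lbrace>x, y\<rbrace> = - \<lbrace>y, x\<rbrace>" by (rule brk_skew)
      then show ?thesis
        using chief_factor_R[OF cf x] chief_factor_trivial(2)[OF cf x]
          subspace_neg[OF gd_idealD(1)[OF U]] by simp
    next
      assume "n - i \<ge> m"
      then have "y \<in> W" using m that(3) by blast
      then show ?thesis using chief_factor_trivial[OF cf] by blast
    qed
  qed
  from m(1) n have "\<not> n \<le> 1" by linarith
  then show ?thesis
    unfolding lower_central.simps[of n] if_not_P[OF \<open>\<not> n \<le> 1\<close>]
    by (intro span_minimal gd_idealD(1)[OF U]) (use prd in auto)
qed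

lemma nilpotent_if_lower_central_subset:
  assumes "gd_ideal W" "m \<ge> 1" "\<And>n. n \<ge> m \<Longrightarrow> lower_central n \<subseteq> W"
  shows nilpotent_gd
  using assms
proof (induction "dim W" arbitrary: W m rule: less_induct)
  case less
  show ?case
  proof (cases "W = {0}")
    case True
    have "0 \<in> lower_central m"
      by (subst lower_central.simps) (simp add: span_zero)
    then have "lower_central m = {0}" using less.prems(3)[of m] True by auto
    then show ?thesis using less.prems(2) unfolding nilpotent_gd_def by blast
  next
    case False
    then obtain U where cf: "chief_factor U W" using ex_chief_factor less.prems(1) by blast
    then have U: "gd_ideal U" "U \<subset> W" unfolding chief_factor_def by blast+
    show ?thesis
    proof (rule less.hyps[OF _ U(1)])
      show "dim U < dim W" using dim_strict_mono gd_idealD(1) U less.prems(1) by blast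
      show "2 * m \<ge> 1" using less.prems(2) by simp
      show "lower_central n \<subseteq> U" if "n \<ge> 2 * m" for n
        using lower_central_descends[OF cf less.prems(2,3) that] .
    qed
  qed
qed

theorem nilpotent: nilpotent_gd
proof (rule nilpotent_if_lower_central_subset)
  show "gd_ideal UNIV" by (simp add: gd_ideal_def)
qed auto

end

theorem theorem3p9:
  fixes scale :: "'k::{alg_closed_field, field_char_0} \<Rightarrow> 'a::ab_group_add \<Rightarrow> 'a"
    and mul brk :: "'a \<Rightarrow> 'a \<Rightarrow> 'a"
    and Basis :: "'a set"
  assumes gd: "gd_algebra scale mul brk"
    and fin_dim: "finite_dimensional_vector_space scale Basis"
    and ad_nilpotent: "\<And>x. nilpotent_op (gd_algebra.ad brk x)"
    and L_nilpotent: "\<And>x. nilpotent_op (gd_algebra.L mul x)"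
    and R_nilpotent: "\<And>x. nilpotent_op (gd_algebra.R mul x)"
    and nil_ideal: "\<And>T. T \<in> gd_algebra.ideal_Rad scale mul brk \<Longrightarrow> nilpotent_op T"
  shows "gd_algebra.nilpotent_gd scale mul brk"
proof -
  interpret gd_algebra scale mul brk by (rule gd)
  interpret finite_dimensional_vector_space scale Basis by (rule fin_dim)
  interpret nil_gd_algebra scale mul brk Basis
    by unfold_locales (fact ad_nilpotent L_nilpotent R_nilpotent nil_ideal)+
  show ?thesis by (rule nilpotent)
qed

end
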